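(* Let $q$ be a power of a prime $p$, let $n,d\in\mathbb{Z}_{\geq 1}$ and let $0\leq s\leq n$ be an integer. Then \begin{align*} \Delta_d(q^n+1,q^n-q^s+1)&=\mathrm{Int}\Bigl(\frac{2}{q}\Bigr)S_d(2,2q^n-q^s)-\sum_{j=1}^{\frac{q^n-q^s}{q-1}}S_d\Bigl(3+(j-1)(q-1),\,2q^n-q^s-1-(j-1)(q-1)\Bigr)\\ &\quad+\sum_{j=\frac{q^n-q^s}{q-1}+1}^{\frac{q^n-1}{q-1}}S_d\Bigl(3+(j-1)(q-1),\,2q^n-q^s-1-(j-1)(q-1)\Bigr), \end{align*} where for $s=0$ the last sum and for $s=n$ the middle sum are empty (equal to $0$).
   Context: $\mathbb{F}_q$ is the finite field with $q$ elements, $A=\mathbb{F}_q[t]$, and $A_{d+}$ is the set of monic polynomials in $A$ of degree $d$. For $s\in\mathbb{Z}$ and $d\in\mathbb{Z}_{\geq0}$, $S_d(s)=\sum_{a\in A_{d+}}a^{-s}\in\mathbb{F}_q(t)$. For $s_1,s_2\in\mathbb{Z}_{>0}$ and $d\in\mathbb{Z}_{\geq 0}$, $S_d(s_1,s_2)=S_d(s_1)\sum_{d>d_2\geq 0}S_{d_2}(s_2)$. For $a,b\in\mathbb{Z}_{>0}$, $\Delta_d(a,b)=S_d(a)S_d(b)-S_d(a+b)$. $\mathrm{Int}(x)=1$ if $x$ is an integer and $0$ otherwise. *)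

theory Defs
  imports "HOL-Computational_Algebra.Computational_Algebra"
begin

text \<open>The field with q elements is a type \<open>'a\<close> of sort \<open>{field, finite}\<close>; its polynomial ring
  A is \<open>'a poly\<close>, and the rational function field is \<open>'a poly fract\<close>.\<close>

definition monic_polys :: "nat \<Rightarrow> 'a::{field,finite} poly set" where
  "monic_polys d = {a. lead_coeff a = 1 \<and> degree a = d}"

definition power_sum :: "nat \<Rightarrow> int \<Rightarrow> 'a::{field,finite} poly fract" where
  "power_sum d s = (\<Sum>a\<in>monic_polys d. to_fract a powi (- s))"

text \<open>The exponents of \<open>power_sum2\<close> and \<open>Delta\<close> are meant to be positive. They have type
  \<open>int\<close> so that subtraction in exponents does not truncate.\<close>

definition power_sum2 :: "nat \<Rightarrow> int \<Rightarrow> int \<Rightarrow> 'a::{field,finite} poly fract" where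
  "power_sum2 d s1 s2 = power_sum d s1 * (\<Sum>d2<d. power_sum d2 s2)"

definition Delta :: "nat \<Rightarrow> int \<Rightarrow> int \<Rightarrow> 'a::{field,finite} poly fract" where
  "Delta d a b = power_sum d a * power_sum d b - power_sum d (a + b)"

definition Int_ind :: "rat \<Rightarrow> 'b::zero_neq_one" where
  "Int_ind x = (if x \<in> \<int> then 1 else 0)"

lemma finite_monic_polys: "finite (monic_polys d :: 'a::{field,finite} poly set)"
proof (rule finite_subset)
  show "monic_polys d \<subseteq> Poly ` {xs :: 'a list. set xs \<subseteq> UNIV \<and> length xs \<le> Suc d}"
  proof
    fix a :: "'a poly"
    assume "a \<in> monic_polys d"
    then have "length (coeffs a) \<le> Suc d"
      by (cases "a = 0") (auto simp: monic_polys_def length_coeffs_degree)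
    then have "coeffs a \<in> {xs. set xs \<subseteq> UNIV \<and> length xs \<le> Suc d}" by simp
    moreover have "a = Poly (coeffs a)" by simp
    ultimately show "a \<in> Poly ` {xs. set xs \<subseteq> UNIV \<and> length xs \<le> Suc d}" by blast
  qed
  show "finite (Poly ` {xs :: 'a list. set xs \<subseteq> UNIV \<and> length xs \<le> Suc d})"
    by (intro finite_imageI finite_lists_length_le) simp
qed

end

theory Submission
  imports Defs "HOL-Library.Cardinality"
begin

text \<open>
  Put $Q = q^n$, $R = q^s$. For distinct monic $x$, $y$ of degree $d$ and $z = x - y$, the elements
  $G = z/x$ and $H = -z/y$ satisfy $GH = G + H$. Since $Q$-th and $R$-th powers are additive, the
  geometric sums of the powers of $G$ and of $H$ collapse to a partial fraction decomposition of
  $x^{-(Q+1)} y^{-(Q-R+1)}$ in which all coefficients are $\<plusminus>1$. Summing it over all pairs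
  $(x, y)$ and writing $z$ as a scalar times a monic polynomial of lower degree, the scalars
  contribute $-1$ if $q - 1$ divides the exponent of $z$ and $0$ otherwise. The exponent $1$ of $x$ cancels, and only the exponents
  in the progression $3 + (j-1)(q-1)$ survive, and also the exponent $2$ when $q = 2$.
\<close>

section \<open>Power sums over a finite field\<close>

lemma of_nat_CARD_eq_0: "of_nat CARD('a) = (0 :: 'a::{ring_1,finite})"
proof -
  \<comment> \<open>Translation by 1 permutes the ring and adds 1 to each of its
    \<open>CARD('a)\<close> elements.\<close>
  have "(\<Sum>x\<in>UNIV. x :: 'a) = (\<Sum>x\<in>UNIV. x + 1)"
    by (rule sum.reindex_bij_witness[where i = "\<lambda>x. x + 1" and j = "\<lambda>x. x - 1"]) auto
  then show ?thesis
    by (simp add: sum.distrib)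
qed

lemma finite_field_power_card_minus_1:
  fixes c :: "'a::{field,finite}"
  assumes "c \<noteq> 0"
  shows "c ^ (CARD('a) - 1) = 1"
proof -
  let ?U = "UNIV - {0 :: 'a}"
  \<comment> \<open>Multiplication by \<open>c\<close> permutes the nonzero elements, whose nonzero
    product then cancels.\<close>
  have "(\<Prod>x\<in>?U. x) = (\<Prod>x\<in>?U. c * x)"
    by (rule prod.reindex_bij_witness[where i = "\<lambda>x. c * x" and j = "\<lambda>x. x / c"])
       (use assms in auto)
  also have "\<dots> = c ^ card ?U * (\<Prod>x\<in>?U. x)"
    by (simp add: prod.distrib)
  finally show ?thesis
    by (simp add: card_Diff_singleton)
qed

text \<open>If \<open>CARD('a) - 1\<close> divides \<open>j\<close>, every term is 1 and the number
  of terms equals -1 in the field. Otherwise some nonzero \<open>c\<close> has \<open>c ^ j\<close>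
  different from 1; scaling the summation variable by \<open>c\<close> multiplies the sum by
  \<open>c ^ j\<close>, so the sum vanishes.\<close>

lemma sum_power_nonzero_finite_field:
  "(\<Sum>c\<in>UNIV - {0 :: 'a::{field,finite}}. c ^ j) = (if CARD('a) - 1 dvd j then - 1 else 0)"
proof (cases "CARD('a) - 1 dvd j")
  case True
  then obtain m where "j = (CARD('a) - 1) * m" ..
  then have "(\<Sum>c\<in>UNIV - {0 :: 'a}. c ^ j) = (\<Sum>c\<in>UNIV - {0 :: 'a}. 1)"
    by (intro sum.cong refl) (simp add: power_mult finite_field_power_card_minus_1 del: One_nat_def)
  also have "\<dots> = of_nat CARD('a) - 1"
    by (simp add: card_Diff_singleton of_nat_diff)
  also have "of_nat CARD('a) = (0 :: 'a)"
    by (rule of_nat_CARD_eq_0)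
  finally show ?thesis
    using True by simp
next
  case False
  define r where "r = j mod (CARD('a) - 1)"
  have r: "r > 0"
    using False by (auto simp: r_def dvd_eq_mod_eq_0)
  have "CARD('a) \<ge> card {0 :: 'a, 1}"
    by (intro card_mono) auto
  then have r_less: "r < CARD('a) - 1"
    by (simp add: r_def)
  \<comment> \<open>Without such a \<open>c\<close>, all \<open>CARD('a) - 1\<close> nonzero
    elements would be roots of \<open>?P\<close>, a nonzero polynomial of degree at most
    \<open>r\<close>, which is too small.\<close>
  have "\<exists>c :: 'a. c \<noteq> 0 \<and> c ^ j \<noteq> 1"
  proof (rule ccontr)
    assume *: "\<not> ?thesis"
    let ?P = "monom 1 r - 1 :: 'a poly"
    have "coeff ?P r = 1"
      using r by simp
    then have nz: "?P \<noteq> 0"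
      by (metis coeff_0 zero_neq_one)
    have "c ^ r = 1" if "c \<noteq> 0" for c :: 'a
    proof -
      have "c ^ j = c ^ ((CARD('a) - 1) * (j div (CARD('a) - 1)) + r)"
        by (simp add: r_def)
      also have "\<dots> = c ^ r"
        using that by (simp add: power_add power_mult finite_field_power_card_minus_1 del: One_nat_def)
      finally show ?thesis
        using * that by auto
    qed
    then have "UNIV - {0} \<subseteq> {x. poly ?P x = 0}"
      by (auto simp: poly_monom)
    then have "card (UNIV - {0 :: 'a}) \<le> card {x. poly ?P x = 0}"
      by (intro card_mono) auto
    also have "\<dots> \<le> degree ?P"
      using nz by (rule card_poly_roots_bound)
    also have "\<dots> \<le> r"
      by (intro degree_diff_le) (auto simp: degree_monom_le)
    finally show False
      using r_less by (simp add: card_Diff_singleton)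
  qed
  then obtain c :: 'a where c: "c \<noteq> 0" "c ^ j \<noteq> 1"
    by blast
  have "(\<Sum>x\<in>UNIV - {0 :: 'a}. x ^ j) = (\<Sum>x\<in>UNIV - {0}. (c * x) ^ j)"
    by (rule sum.reindex_bij_witness[where i = "\<lambda>x. c * x" and j = "\<lambda>x. x / c"])
       (use c in auto)
  also have "\<dots> = c ^ j * (\<Sum>x\<in>UNIV - {0}. x ^ j)"
    by (simp add: power_mult_distrib sum_distrib_left)
  finally show ?thesis
    using c False by simp
qed

section \<open>Sums over nonzero polynomials of bounded degree\<close>

lemma to_fract_of_nat: "to_fract (of_nat n) = of_nat n"
  by (induction n) simp_all

lemma to_fract_power: "to_fract (x ^ n) = to_fract x ^ n"
  by (induction n) simp_all

text \<open>Lets the Frobenius identity be used in the rational function field.\<close>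

lemma CHAR_fract [simp]: "CHAR('a::idom fract) = CHAR('a)"
  by (rule CHAR_eqI) (auto simp flip: to_fract_of_nat simp: of_nat_eq_0_iff_char_dvd)

lemma sum_pCons_0: "(\<Sum>x\<in>A. [:f x:]) = [:\<Sum>x\<in>A. f x:]"
  by (induction A rule: infinite_finite_induct) auto

lemma power_sum_altdef:
  "power_sum d (int s) = (\<Sum>a\<in>monic_polys d. inverse (to_fract a) ^ s)"
  by (simp add: power_sum_def power_int_minus power_inverse)

text \<open>Each \<open>z\<close> is uniquely its leading coefficient times a monic polynomial, so
  the sum is a product. The scalar factor is a power sum over the field, hence -1 or 0; the monic
  factor collects all degrees below \<open>d\<close>.\<close>

lemma sum_nonzero_polys_inverse_power:
  "(\<Sum>z | z \<noteq> 0 \<and> degree z < d. inverse (to_fract (z :: 'a::{field,finite} poly)) ^ j) =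
    (if CARD('a) - 1 dvd j then - (\<Sum>d2<d. power_sum d2 (int j)) else 0)"
proof -
  let ?\<phi> = "\<lambda>c :: 'a. to_fract [:c:]"
  let ?D = "SIGMA m:(\<Union>d2<d. monic_polys d2 :: 'a poly set). UNIV - {0 :: 'a}"
  have inv: "inverse (?\<phi> c) = ?\<phi> (inverse c)" if "c \<noteq> 0" for c
    using that by (intro inverse_unique) (simp flip: to_fract_mult add: one_pCons[symmetric])
  \<comment> \<open>Inversion permutes the nonzero scalars, which turns the exponent -j into
    j.\<close>
  have "(\<Sum>c\<in>UNIV - {0}. inverse (?\<phi> c) ^ j) = (\<Sum>c\<in>UNIV - {0}. ?\<phi> c ^ j)"
    by (rule sum.reindex_bij_witness[where i = inverse and j = inverse]) (auto simp: inv)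
  also have "\<dots> = ?\<phi> (\<Sum>c\<in>UNIV - {0}. c ^ j)"
    by (simp add: poly_const_pow flip: to_fract_power to_fract_sum sum_pCons_0)
  also have "\<dots> = (if CARD('a) - 1 dvd j then - 1 else 0)"
  proof -
    have "[:- 1 :: 'a:] = - 1"
      by (simp add: one_pCons)
    then show ?thesis
      by (simp add: sum_power_nonzero_finite_field)
  qed
  finally have const: "(\<Sum>c\<in>UNIV - {0}. inverse (?\<phi> c) ^ j) =
    (if CARD('a) - 1 dvd j then - 1 else 0)" .
  have "(\<Sum>z | z \<noteq> 0 \<and> degree z < d. inverse (to_fract z) ^ j) =
      (\<Sum>(m, c)\<in>?D. inverse (to_fract m) ^ j * inverse (?\<phi> c) ^ j)"
  proof (rule sum.reindex_bij_witness[where i = "\<lambda>(m, c). smult c m"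
        and j = "\<lambda>z. (smult (inverse (lead_coeff z)) z, lead_coeff z)"], goal_cases)
    case (5 z)
    have "?\<phi> (lead_coeff z) * to_fract (smult (inverse (lead_coeff z)) z) = to_fract z"
      using 5 by (simp flip: to_fract_mult)
    then show ?case
      by (simp add: mult.commute flip: power_mult_distrib inverse_mult_distrib)
  qed (auto simp: monic_polys_def)
  also have "\<dots> = (\<Sum>m\<in>(\<Union>d2<d. monic_polys d2). inverse (to_fract m) ^ j) *
      (\<Sum>c\<in>UNIV - {0}. inverse (?\<phi> c) ^ j)"
    by (simp add: sum_product sum.cartesian_product)
  also have "(\<Sum>m\<in>(\<Union>d2<d. monic_polys d2 :: 'a poly set). inverse (to_fract m) ^ j) =
      (\<Sum>d2<d. power_sum d2 (int j))"
    unfolding power_sum_altdef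
    by (rule sum.UNION_disjoint) (auto simp: finite_monic_polys, auto simp: monic_polys_def)
  finally show ?thesis
    by (simp add: const)
qed

section \<open>Ordered pairs of distinct monic polynomials\<close>

lemma monic_polys_translate:
  fixes x :: "'a::{field,finite} poly"
  assumes "x \<in> monic_polys d" "d \<ge> 1"
  shows "bij_betw (\<lambda>z. x - z) {z. z \<noteq> 0 \<and> degree z < d} (monic_polys d - {x})"
proof (rule bij_betwI[where g = "\<lambda>y. x - y"])
  show "(\<lambda>z. x - z) \<in> {z. z \<noteq> 0 \<and> degree z < d} \<rightarrow> monic_polys d - {x}"
  proof
    fix z :: "'a poly" assume z: "z \<in> {z. z \<noteq> 0 \<and> degree z < d}"
    then have "degree (x - z) = d"
      using assms degree_add_eq_left[of "- z" x] by (simp add: monic_polys_def)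
    then show "x - z \<in> monic_polys d - {x}"
      using assms z by (auto simp: monic_polys_def coeff_eq_0)
  qed
  show "(\<lambda>y. x - y) \<in> monic_polys d - {x} \<rightarrow> {z. z \<noteq> 0 \<and> degree z < d}"
  proof
    fix y :: "'a poly" assume y: "y \<in> monic_polys d - {x}"
    then have "degree (x - y) \<le> d" "coeff (x - y) d = 0"
      using assms by (auto simp: monic_polys_def intro: degree_diff_le)
    then show "x - y \<in> {z. z \<noteq> 0 \<and> degree z < d}"
      using assms y by (auto dest: eq_zero_or_degree_less)
  qed
qed auto

text \<open>With z = x - y as the new variable, the range of the inner sum no longer depends on
  \<open>x\<close>, and the double sum factors.\<close>

lemma sum_monic_pairs:
  assumes "d \<ge> 1"
  shows "(\<Sum>x\<in>monic_polys d. \<Sum>y\<in>monic_polys d - {x}.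
      inverse (to_fract x - to_fract y) ^ j * inverse (to_fract (x :: 'a::{field,finite} poly)) ^ i) =
    (if CARD('a) - 1 dvd j then - power_sum2 d (int i) (int j) else 0)" (is "?lhs = _")
proof -
  have "?lhs = (\<Sum>x\<in>monic_polys d. inverse (to_fract (x :: 'a poly)) ^ i *
      (\<Sum>z | z \<noteq> 0 \<and> degree z < d. inverse (to_fract (z :: 'a poly)) ^ j))"
  proof (rule sum.cong[OF refl])
    fix x :: "'a poly" assume "x \<in> monic_polys d"
    from sum.reindex_bij_betw[OF monic_polys_translate[OF this assms],
        of "\<lambda>y. inverse (to_fract x - to_fract y) ^ j * inverse (to_fract x) ^ i"]
    show "(\<Sum>y\<in>monic_polys d - {x}.
        inverse (to_fract x - to_fract y) ^ j * inverse (to_fract x) ^ i) =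
      inverse (to_fract x) ^ i * (\<Sum>z | z \<noteq> 0 \<and> degree z < d. inverse (to_fract z) ^ j)"
      by (simp add: sum_distrib_left mult.commute)
  qed
  then show ?thesis
    by (simp add: sum_nonzero_polys_inverse_power power_sum2_def power_sum_altdef
        flip: sum_distrib_right)
qed

section \<open>The partial fraction decomposition\<close>

text \<open>The relation \<open>GH\<close> says (G - 1)(H - 1) = 1. The first geometric sum is
  G^(Q-R+2) (G-1)^(R-1), by additivity of the R-th power; the second is G (H^(Q-R+1) - 1), whose -G
  cancels the lone \<open>G\<close>. Multiplied by H^(R-1), the right side becomes G^(Q+1) + G H^Q =
  G (G+H)^Q = G (GH)^Q, which is H^(R-1) times the left side.\<close>

lemma geometric_sums_partial_fraction:
  fixes G H :: "'b::field"
  assumes "G \<noteq> 0" "H \<noteq> 0" and GH: "G * H = G + H"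
    and Q: "(G + H) ^ Q = G ^ Q + H ^ Q" and R: "(G - 1) ^ R = G ^ R - 1"
    and "1 \<le> R" "R \<le> Q"
  shows "G ^ (Q + 1) * H ^ (Q - R + 1) =
    (\<Sum>e = Q - R + 2..Q + 1. G ^ e) + G + (\<Sum>e = 1..Q - R + 1. H ^ e)"
proof -
  have G1: "(G - 1) * H = G" and H1: "(H - 1) * G = H"
    using GH by (auto simp: algebra_simps)
  have ne: "G - 1 \<noteq> 0" "H - 1 \<noteq> 0"
    using G1 H1 assms by auto
  obtain r where r: "R = Suc r"
    using \<open>1 \<le> R\<close> by (cases R) auto
  obtain b where b: "Q = R + b"
    using \<open>R \<le> Q\<close> le_Suc_ex by blast
  have "(G - 1) * (\<Sum>e = Q - R + 2..Q + 1. G ^ e) = - ((1 - G) * (\<Sum>e = Q - R + 2..Q + 1. G ^ e))"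
    by (simp only: minus_mult_left minus_diff_eq)
  also have "\<dots> = G ^ (b + 2 + R) - G ^ (b + 2)"
    using \<open>1 \<le> R\<close> by (subst sum_gp_multiplied) (simp_all add: b add_ac)
  also have "\<dots> = G ^ (b + 2) * (G - 1) ^ R"
    by (simp add: R right_diff_distrib power_add)
  finally have "(G - 1) * (\<Sum>e = Q - R + 2..Q + 1. G ^ e) = G ^ (b + 2) * (G - 1) ^ R" .
  then have sG: "(\<Sum>e = Q - R + 2..Q + 1. G ^ e) = G ^ (b + 2) * (G - 1) ^ r"
    using ne by (simp only: r power_Suc mult.left_commute[of _ "G - 1"] mult_cancel_left) simp
  \<comment> \<open>The factor \<open>H ^ r\<close> is chosen so that (G - 1) H = G clears the power
    of G - 1.\<close>
  have "H ^ r * (\<Sum>e = Q - R + 2..Q + 1. G ^ e) = G ^ (b + 2) * ((G - 1) * H) ^ r"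
    unfolding sG by (simp add: power_mult_distrib)
  then have sG': "H ^ r * (\<Sum>e = Q - R + 2..Q + 1. G ^ e) = G ^ (Q + 1)"
    by (simp add: G1 b r power_add)
  have "(H - 1) * (\<Sum>e = 1..Q - R + 1. H ^ e) = - ((1 - H) * (\<Sum>e = 1..Q - R + 1. H ^ e))"
    by (simp only: minus_mult_left minus_diff_eq)
  also have "\<dots> = H * (H ^ (Q - R + 1) - 1)"
    by (subst sum_gp_multiplied) (simp_all add: right_diff_distrib)
  also have "\<dots> = (H - 1) * (G * (H ^ (Q - R + 1) - 1))"
    using H1 by (metis mult.assoc)
  finally have sH: "(\<Sum>e = 1..Q - R + 1. H ^ e) = G * (H ^ (Q - R + 1) - 1)"
    using ne by simp
  have "H ^ r * ((\<Sum>e = Q - R + 2..Q + 1. G ^ e) + G + (\<Sum>e = 1..Q - R + 1. H ^ e)) =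
      G ^ (Q + 1) + G * H ^ Q"
    unfolding sH distrib_left sG' by (simp add: b r algebra_simps power_add)
  also have "\<dots> = G * (G * H) ^ Q"
    by (simp add: GH Q algebra_simps)
  also have "\<dots> = H ^ r * (G ^ (Q + 1) * H ^ (Q - R + 1))"
    by (simp add: b r power_add power_mult_distrib)
  finally show ?thesis
    using assms by simp
qed

text \<open>This is the previous identity for G = z/x and H = -z/y, divided by z^N, where
  \<open>N\<close> is the total exponent on the left. The first sum is written with y - x so that
  each term has the shape of \<open>sum_monic_pairs\<close>, up to exchanging \<open>x\<close> and
  \<open>y\<close>.\<close>

lemma partial_fraction_prime_char:
  fixes x y :: "'b::field"
  assumes "x \<noteq> 0" "y \<noteq> 0" "x \<noteq> y"
    and Q: "\<And>u v :: 'b. (u + v) ^ Q = u ^ Q + v ^ Q"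
    and R: "\<And>u v :: 'b. (u + v) ^ R = u ^ R + v ^ R"
    and "1 \<le> R" "R \<le> Q"
  defines "N \<equiv> 2 * Q - R + 2"
  shows "inverse x ^ (Q + 1) * inverse y ^ (Q - R + 1) =
    (\<Sum>e = 1..Q - R + 1. inverse (y - x) ^ (N - e) * inverse y ^ e)
    - (\<Sum>e = Q - R + 2..Q + 1. inverse (x - y) ^ (N - e) * inverse x ^ e)
    - inverse (x - y) ^ (N - 1) * inverse x ^ 1"
proof -
  \<comment> \<open>Additivity applied to 1 + (-1) = 0 fixes this sign in every characteristic, with
    no parity argument.\<close>
  have neg1: "(- 1 :: 'b) ^ m = - 1" if "\<And>u v :: 'b. (u + v) ^ m = u ^ m + v ^ m" "m \<ge> 1" for m
    using that(1)[of 1 "-1"] that(2) by (simp add: power_0_left eq_neg_iff_add_eq_0 add.commute)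
  have neg1Q: "(- 1 :: 'b) ^ Q = - 1" and neg1R: "(- 1 :: 'b) ^ R = - 1"
    using neg1[of Q] neg1[of R] Q R assms by auto
  define z where "z = x - y"
  define G H where "G = z / x" and "H = - z / y"
  have z: "z \<noteq> 0" "y - x = - z"
    using assms by (auto simp: z_def)
  have nz: "G \<noteq> 0" "H \<noteq> 0"
    using z assms by (auto simp: G_def H_def)
  have "G * H = G + H"
    using assms by (simp add: G_def H_def z_def field_simps)
  moreover have "(G - 1) ^ R = G ^ R - 1"
    using R[of G "- 1"] neg1R by simp
  ultimately have id: "G ^ (Q + 1) * H ^ (Q - R + 1) =
      (\<Sum>e = Q - R + 2..Q + 1. G ^ e) + G + (\<Sum>e = 1..Q - R + 1. H ^ e)"
    using nz Q assms by (intro geometric_sums_partial_fraction) auto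
  have R': "(- 1 :: 'b) ^ (Q - R) = 1"
  proof -
    have "(- 1 :: 'b) ^ (Q - R) * (- 1) ^ R = (- 1) ^ Q"
      using \<open>R \<le> Q\<close> by (simp flip: power_add)
    then show ?thesis
      by (simp add: neg1Q neg1R)
  qed
  have N: "N = Q + (Q - R) + 2" "N = (Q + 1) + (Q - R + 1)"
    using assms by auto
  have "(- 1 :: 'b) ^ N = - 1"
    by (simp add: N(1) power_add R' neg1Q)
  then have zN: "inverse (- z) ^ N = - (inverse z ^ N)"
    using power_mult_distrib[of "- 1" "inverse z" N] by simp
  have Gx: "inverse z ^ (N - e) * inverse x ^ e = inverse z ^ N * G ^ e" if "e \<le> N" for e
  proof -
    have "inverse z ^ N = inverse z ^ (N - e) * inverse z ^ e"
      using that by (simp flip: power_add)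
    then show ?thesis
      using z by (simp add: G_def field_simps)
  qed
  \<comment> \<open>The minus sign comes from replacing z^(-N) by (-z)^(-N), as (-1)^N = -1.\<close>
  have Hy: "inverse (- z) ^ (N - e) * inverse y ^ e = - (inverse z ^ N * H ^ e)" if "e \<le> N" for e
  proof -
    have "inverse (- z) ^ N = inverse (- z) ^ (N - e) * inverse (- z) ^ e"
      using that by (simp flip: power_add)
    moreover have "inverse (- z) ^ e * H ^ e = inverse y ^ e"
      using z by (simp add: H_def field_simps flip: power_mult_distrib)
    ultimately have "inverse (- z) ^ (N - e) * inverse y ^ e = inverse (- z) ^ N * H ^ e"
      by (simp add: mult.assoc)
    then show ?thesis
      by (simp only: zN mult_minus_left)
  qed
  have "inverse y ^ (Q - R + 1) = - (inverse z ^ (Q - R + 1) * H ^ (Q - R + 1))"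
  proof -
    have "inverse y = - 1 * (inverse z * H)"
      using z assms by (simp add: H_def field_simps)
    then have "inverse y ^ (Q - R + 1) = (- 1) ^ (Q - R + 1) * (inverse z * H) ^ (Q - R + 1)"
      by (simp only: power_mult_distrib)
    then show ?thesis
      by (simp add: R' power_mult_distrib)
  qed
  moreover have "inverse x ^ (Q + 1) = inverse z ^ (Q + 1) * G ^ (Q + 1)"
    using z by (simp add: G_def field_simps flip: power_mult_distrib)
  ultimately have "inverse x ^ (Q + 1) * inverse y ^ (Q - R + 1) =
      - (inverse z ^ N * (G ^ (Q + 1) * H ^ (Q - R + 1)))"
    unfolding N(2) power_add[of _ "Q + 1" "Q - R + 1"] by (simp only: ac_simps mult_minus_right)
  also have "\<dots> = (\<Sum>e = 1..Q - R + 1. - (inverse z ^ N * H ^ e))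
      - (\<Sum>e = Q - R + 2..Q + 1. inverse z ^ N * G ^ e) - inverse z ^ N * G ^ 1"
    unfolding id by (simp add: algebra_simps sum_negf sum_distrib_left)
  also have "(\<Sum>e = 1..Q - R + 1. - (inverse z ^ N * H ^ e)) =
      (\<Sum>e = 1..Q - R + 1. inverse (- z) ^ (N - e) * inverse y ^ e)"
    by (intro sum.cong refl Hy[symmetric]) (simp add: N)
  also have "(\<Sum>e = Q - R + 2..Q + 1. inverse z ^ N * G ^ e) =
      (\<Sum>e = Q - R + 2..Q + 1. inverse z ^ (N - e) * inverse x ^ e)"
    by (intro sum.cong refl Gx[symmetric]) (simp add: N)
  also have "inverse z ^ N * G ^ 1 = inverse z ^ (N - 1) * inverse x ^ 1"
    by (intro Gx[symmetric]) (simp add: N)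
  finally show ?thesis
    unfolding z(2) unfolding z_def .
qed

section \<open>Summation over pairs\<close>

text \<open>Summing the decomposition over all pairs turns each term with exponent \<open>e\<close>
  into \<open>- T e\<close>. The value 0 in \<open>T\<close> records the vanishing of the sum over
  scalars.\<close>

lemma Delta_eq_power_sum2_sums:
  fixes d Q R :: nat
  assumes "d \<ge> 1"
    and Q: "\<And>u v :: 'a::{field,finite} poly fract. (u + v) ^ Q = u ^ Q + v ^ Q"
    and R: "\<And>u v :: 'a poly fract. (u + v) ^ R = u ^ R + v ^ R"
    and "1 \<le> R" "R \<le> Q"
  defines "T \<equiv> \<lambda>e. if CARD('a) - 1 dvd 2 * Q - R + 2 - e
    then power_sum2 d (int e) (int (2 * Q - R + 2 - e)) else (0 :: 'a poly fract)"
  shows "Delta d (int (Q + 1)) (int (Q - R + 1)) =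
    (\<Sum>e = Q - R + 2..Q + 1. T e) - (\<Sum>e = 2..Q - R + 1. T e)"
proof -
  let ?M = "monic_polys d :: 'a poly set"
  define N where "N = 2 * Q - R + 2"
  define W where "W = (\<lambda>e (x :: 'a poly) y.
    inverse (to_fract x - to_fract y) ^ (N - e) * inverse (to_fract x) ^ e)"
  have fin: "finite ?M"
    by (rule finite_monic_polys)
  have W: "(\<Sum>x\<in>?M. \<Sum>y\<in>?M - {x}. W e x y) = - T e" for e
    using sum_monic_pairs[OF assms(1), where ?'a = 'a, of "N - e" e]
    by (simp add: W_def T_def N_def)
  \<comment> \<open>Exchanging the members of each pair reduces the terms in \<open>y\<close> to
    those in \<open>x\<close>.\<close>
  have swap: "(\<Sum>x\<in>?M. \<Sum>y\<in>?M - {x}. f x y) = (\<Sum>x\<in>?M. \<Sum>y\<in>?M - {x}. f y x)"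
    for f :: "_ \<Rightarrow> _ \<Rightarrow> 'a poly fract"
    using sum.swap_restrict[OF fin fin, of f "\<lambda>x y. y \<noteq> x"]
    by (simp add: set_diff_eq eq_commute)
  have W': "(\<Sum>x\<in>?M. \<Sum>y\<in>?M - {x}. W e y x) = - T e" for e
    using W[of e] swap[of "W e"] by simp
  have sum_out: "(\<Sum>x\<in>?M. \<Sum>y\<in>?M - {x}. \<Sum>e\<in>A. f e x y) =
      (\<Sum>e\<in>A. \<Sum>x\<in>?M. \<Sum>y\<in>?M - {x}. f e x y)"
    for f :: "nat \<Rightarrow> _ \<Rightarrow> _ \<Rightarrow> 'a poly fract" and A
    unfolding sum.swap[of _ A] ..
  have nz: "x \<noteq> 0" if "x \<in> ?M" for x
    using that by (auto simp: monic_polys_def)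
  have "Delta d (int (Q + 1)) (int (Q - R + 1)) =
      (\<Sum>x\<in>?M. (\<Sum>y\<in>?M. inverse (to_fract x) ^ (Q + 1) * inverse (to_fract y) ^ (Q - R + 1))
        - inverse (to_fract x) ^ (Q + 1 + (Q - R + 1)))"
    unfolding Delta_def of_nat_add[symmetric] power_sum_altdef
    by (simp only: sum_product sum_subtractf)
  \<comment> \<open>The diagonal y = x is exactly the power sum that \<open>Delta\<close>
    subtracts.\<close>
  also have "\<dots> = (\<Sum>x\<in>?M. \<Sum>y\<in>?M - {x}.
      inverse (to_fract x) ^ (Q + 1) * inverse (to_fract y) ^ (Q - R + 1))"
    by (intro sum.cong refl) (simp only: sum.remove[OF fin] power_add add_diff_cancel_left')
  also have "\<dots> = (\<Sum>x\<in>?M. \<Sum>y\<in>?M - {x}.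
      (\<Sum>e = 1..Q - R + 1. W e y x) - (\<Sum>e = Q - R + 2..Q + 1. W e x y) - W 1 x y)"
    unfolding W_def N_def
    by (intro sum.cong refl partial_fraction_prime_char) (use assms nz in auto)
  also have "\<dots> = (\<Sum>e = 1..Q - R + 1. \<Sum>x\<in>?M. \<Sum>y\<in>?M - {x}. W e y x)
      - (\<Sum>e = Q - R + 2..Q + 1. \<Sum>x\<in>?M. \<Sum>y\<in>?M - {x}. W e x y)
      - (\<Sum>x\<in>?M. \<Sum>y\<in>?M - {x}. W 1 x y)"
    by (simp only: sum_subtractf sum_out)
  also have "\<dots> = (\<Sum>e = Q - R + 2..Q + 1. T e) - (\<Sum>e = 1..Q - R + 1. T e) + T 1"
    unfolding W W' by (simp add: sum_negf)
  \<comment> \<open>Splitting off e = 1 lets it cancel against the isolated term.\<close>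
  also have "(\<Sum>e = 1..Q - R + 1. T e) = T 1 + (\<Sum>e = 2..Q - R + 1. T e)"
    by (subst sum.atLeast_Suc_atMost) (auto simp: numeral_2_eq_2)
  finally show ?thesis
    by simp
qed

section \<open>Reindexing by an arithmetic progression and conclusion\<close>

lemma mult_minus_1_div_eq:
  fixes q :: nat
  assumes "q \<ge> 2" "s \<le> n"
  shows "(q - 1) * ((q ^ n - q ^ s) div (q - 1)) = q ^ n - q ^ s"
proof -
  have "int q - 1 dvd int q ^ n - int q ^ s"
  proof -
    have "int q ^ n - int q ^ s = int q ^ s * (int q ^ (n - s) - 1)"
      using assms by (simp add: right_diff_distrib flip: power_add)
    then show ?thesis
      by (simp add: power_diff_1_eq)
  qed
  moreover have "int (q ^ n - q ^ s) = int q ^ n - int q ^ s" "int (q - 1) = int q - 1"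
    using assms by (simp_all add: of_nat_diff power_increasing)
  ultimately have "q - 1 dvd q ^ n - q ^ s"
    by (metis of_nat_dvd_iff)
  then show ?thesis
    by simp
qed

text \<open>The test selects the \<open>e\<close> congruent to 3 modulo \<open>c\<close>. As c >= 2,
  the end points cl + 2 and cu + v, for either \<open>v\<close>, enclose precisely the members with
  index from l + 1 to u.\<close>

lemma sum_arithmetic_progression_filter:
  fixes c l u m v :: nat and f :: "nat \<Rightarrow> 'b::comm_monoid_add"
  assumes "c \<ge> 2" "u \<le> m" "v \<in> {1, 2}"
  shows "(\<Sum>e = c * l + 2..c * u + v. if c dvd c * m + 3 - e then f e else 0) =
    (\<Sum>j = l + 1..u. f (3 + (j - 1) * c))"
proof -
  have "1 \<le> v" "v \<le> 2"
    using assms by auto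
  have "(\<Sum>e = c * l + 2..c * u + v. if c dvd c * m + 3 - e then f e else 0) =
      (\<Sum>e | e \<in> {c * l + 2..c * u + v} \<and> c dvd c * m + 3 - e. f e)"
    by (subst sum.inter_filter) simp_all
  also have "\<dots> = (\<Sum>j = l + 1..u. f (3 + (j - 1) * c))"
  proof (rule sum.reindex_bij_witness[where i = "\<lambda>j. 3 + (j - 1) * c" and j = "\<lambda>e. (e - 3) div c + 1"])
    fix e assume e: "e \<in> {e. e \<in> {c * l + 2..c * u + v} \<and> c dvd c * m + 3 - e}"
    then obtain t where t: "c * m + 3 - e = c * t"
      by auto
    have "c * u \<le> c * m"
      using assms by simp
    moreover have "c * l + 2 \<le> e" "e \<le> c * u + v"
      using e by auto
    ultimately have e3: "c * m + 3 = e + c * t" and "c * t \<le> c * m + 1"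
      using t \<open>v \<le> 2\<close> by linarith+
    \<comment> \<open>A larger \<open>t\<close> would mean e < 3. Excluding it, in particular e = 2,
      keeps \<open>e - 3\<close> from truncating.\<close>
    have "t \<le> m"
    proof (rule ccontr)
      assume "\<not> t \<le> m"
      then have "c * (m + 1) \<le> c * t"
        by (intro mult_le_mono2) simp
      then show False
        using \<open>c * t \<le> c * m + 1\<close> \<open>c \<ge> 2\<close> by simp
    qed
    then obtain i where i: "m = t + i"
      using le_Suc_ex by blast
    have ei: "e = c * i + 3"
      using e3 by (simp add: i algebra_simps)
    then have j: "(e - 3) div c + 1 = i + 1"
      using assms by simp
    show "3 + ((e - 3) div c + 1 - 1) * c = e"
      unfolding j by (simp add: ei)
    then show "f (3 + ((e - 3) div c + 1 - 1) * c) = f e"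
      by simp
    have "c * i < c * u" and "c * l < c * (i + 1)"
      using \<open>c * l + 2 \<le> e\<close> \<open>e \<le> c * u + v\<close> \<open>v \<le> 2\<close> \<open>c \<ge> 2\<close>
      unfolding ei distrib_left by linarith+
    then have "i < u" "l < i + 1"
      by (simp_all only: mult_less_cancel1)
    then show "(e - 3) div c + 1 \<in> {l + 1..u}"
      unfolding j by simp
  next
    fix j assume "j \<in> {l + 1..u}"
    then obtain i where i: "j = i + 1" "l \<le> i" "i + 1 \<le> u"
      by (cases j) auto
    show "(3 + (j - 1) * c - 3) div c + 1 = j"
      using i assms by simp
    have "c * l \<le> c * i" "c * (i + 1) \<le> c * u"
      using i by (intro mult_le_mono2; simp)+
    then have "c * l + 2 \<le> 3 + c * i" "3 + c * i \<le> c * u + v"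
      using \<open>1 \<le> v\<close> \<open>c \<ge> 2\<close> unfolding distrib_left by linarith+
    moreover have "c * m + 3 - (3 + i * c) = c * (m - i)"
      by (simp add: algebra_simps diff_mult_distrib2)
    ultimately show "3 + (j - 1) * c \<in> {e. e \<in> {c * l + 2..c * u + v} \<and> c dvd c * m + 3 - e}"
      using assms by (simp add: i mult.commute)
  qed
  finally show ?thesis .
qed

theorem theorem3p4:
  fixes p k q n d s :: nat
  assumes "prime p" and "k \<ge> 1" and "q = p ^ k"
    and "card (UNIV :: 'a::{field,finite} set) = q"
    and "n \<ge> 1" and "d \<ge> 1" and "s \<le> n"
  shows "(Delta d (int q ^ n + 1) (int q ^ n - int q ^ s + 1) :: 'a poly fract) =
    Int_ind (2 / of_nat q) * power_sum2 d 2 (2 * int q ^ n - int q ^ s)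
    - (\<Sum>j = 1..(q ^ n - q ^ s) div (q - 1).
         power_sum2 d (3 + (int j - 1) * (int q - 1))
                      (2 * int q ^ n - int q ^ s - 1 - (int j - 1) * (int q - 1)))
    + (\<Sum>j = (q ^ n - q ^ s) div (q - 1) + 1..(q ^ n - 1) div (q - 1).
         power_sum2 d (3 + (int j - 1) * (int q - 1))
                      (2 * int q ^ n - int q ^ s - 1 - (int j - 1) * (int q - 1)))"
proof -
  define Q R where "Q = q ^ n" and "R = q ^ s"
  define M K where "M = (Q - R) div (q - 1)" and "K = (Q - 1) div (q - 1)"
  \<comment> \<open>The divisibility test is kept outside this \<open>T\<close>, so that the
    filtered sums can be reindexed.\<close>
  define T where "T = (\<lambda>e. power_sum2 d (int e) (int (2 * Q - R + 2 - e)) :: 'a poly fract)"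
  have q2: "q \<ge> 2"
    using assms prime_ge_2_nat[OF \<open>prime p\<close>] self_le_power[of p k] by simp
  have RQ: "1 \<le> R" "R \<le> Q"
    using q2 assms by (auto simp: Q_def R_def intro: power_increasing)
  have M: "(q - 1) * M = Q - R"
    using mult_minus_1_div_eq[OF q2 \<open>s \<le> n\<close>] by (simp add: M_def Q_def R_def)
  have K: "(q - 1) * K = Q - 1"
    using mult_minus_1_div_eq[OF q2, of 0 n] by (simp add: K_def Q_def)
  have "M \<le> K"
    using RQ by (auto simp: M_def K_def intro: div_le_mono)

  \<comment> \<open>The characteristic is a prime dividing p^k, hence \<open>p\<close>; so taking
    powers with exponent q^m is additive.\<close>
  have "prime CHAR('a)"
    by (intro prime_CHAR_semidom finite_imp_CHAR_pos) simp
  moreover have "CHAR('a) dvd p ^ k"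
    using of_nat_CARD_eq_0[where ?'a = 'a] assms by (simp only: of_nat_eq_0_iff_char_dvd)
  ultimately have p: "CHAR('a) = p"
    using \<open>prime p\<close> prime_dvd_power primes_dvd_imp_eq by blast
  have frob: "(u + v) ^ (q ^ m) = u ^ (q ^ m) + v ^ (q ^ m)" for u v :: "'a poly fract" and m
    by (rule freshmans_dream') (use assms p in \<open>auto simp flip: power_mult\<close>)

  have T: "T (3 + (j - 1) * (q - 1)) = power_sum2 d (3 + (int j - 1) * (int q - 1))
      (2 * int q ^ n - int q ^ s - 1 - (int j - 1) * (int q - 1))" if "1 \<le> j" "j \<le> K" for j
  proof -
    have "(q - 1) * j \<le> Q - 1"
      using that unfolding K[symmetric] by simp
    then have "(j - 1) * (q - 1) \<le> Q - 1"
      using that by (metis diff_le_self le_trans mult.commute mult_le_mono2)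
    \<comment> \<open>The bound on \<open>j\<close> and R <= Q ensure that the natural subtraction
      does not truncate.\<close>
    then have "int (2 * Q - R + 2 - (3 + (j - 1) * (q - 1))) =
        2 * int Q - int R - 1 - int ((j - 1) * (q - 1))"
      using RQ by linarith
    then show ?thesis
      using that q2 by (simp add: T_def of_nat_diff) (simp add: Q_def R_def)
  qed
  have "(Delta d (int q ^ n + 1) (int q ^ n - int q ^ s + 1) :: 'a poly fract) =
      Delta d (int (Q + 1)) (int (Q - R + 1))"
    using RQ by (simp add: of_nat_diff add.commute) (simp add: Q_def R_def)
  also have "\<dots> = (\<Sum>e = Q - R + 2..Q + 1. if q - 1 dvd 2 * Q - R + 2 - e then T e else 0)
      - (\<Sum>e = 2..Q - R + 1. if q - 1 dvd 2 * Q - R + 2 - e then T e else 0)"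
    unfolding T_def assms(4)[symmetric]
    by (rule Delta_eq_power_sum2_sums) (use assms(6) RQ frob in \<open>simp_all only: Q_def R_def\<close>)
  also have "\<dots> = Int_ind (2 / of_nat q) * T 2
      - (\<Sum>j = 1..M. T (3 + (j - 1) * (q - 1))) + (\<Sum>j = M + 1..K. T (3 + (j - 1) * (q - 1)))"
  \<comment> \<open>For q = 2 the test modulo q - 1 = 1 always succeeds, so e = 2 survives; for q >=
    3 only the progression does.\<close>
  proof (cases "q = 2")
    case True
    have "p = 2"
      using True assms primes_dvd_imp_eq[of p 2] by (metis dvd_power order_less_le_trans prime_nat_iff
          two_is_prime_nat zero_less_one)
    then have two: "(2 :: 'a poly fract) = 0"
      using of_nat_CHAR[where ?'a = "'a poly fract"] p by simp
    have neg: "- x = x" for x :: "'a poly fract"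
    proof -
      have "x + x = 2 * x" by simp
      then show ?thesis by (simp add: two eq_neg_iff_add_eq_0 neg_eq_iff_add_eq_0)
    qed
    have minus: "x - y = x + y" for x y :: "'a poly fract"
      using neg[of y] by (metis diff_conv_add_uminus)
    have QM: "Q - R = M" "Q = K + 1"
      using M K True RQ by auto
    have shift: "(\<Sum>j = a + 1..b. T (3 + (j - 1))) = (\<Sum>e = a + 3..b + 2. T e)" for a b
      by (rule sum.reindex_bij_witness[where i = "\<lambda>e. e - 2" and j = "\<lambda>j. j + 2"]) auto
    have split: "(\<Sum>e = a..c. T e) = (\<Sum>e = a..b. T e) + (\<Sum>e = b + 1..c. T e)"
      if "a \<le> b + 1" "b \<le> c" for a b c
      using sum.ub_add_nat[OF that(1), of T "c - b"] that(2) by simp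
    \<comment> \<open>Signs disappear in characteristic 2, so both sides equal this sum: one cuts it
      after M + 1, the other after 2 and M + 2.\<close>
    have "(\<Sum>e = 2..K + 2. T e) = (\<Sum>e = 2..M + 1. T e) + (\<Sum>e = M + 2..K + 2. T e)"
      using split[of 2 "M + 1" "K + 2"] \<open>M \<le> K\<close> by (simp add: numeral_eq_Suc del: sum.cl_ivl_Suc)
    moreover have "(\<Sum>e = 2..K + 2. T e) = T 2 + (\<Sum>e = 3..K + 2. T e)"
      using sum.atLeast_Suc_atMost[of 2 "K + 2" T] by (simp del: sum.cl_ivl_Suc)
    moreover have "(\<Sum>e = 3..K + 2. T e) = (\<Sum>e = 3..M + 2. T e) + (\<Sum>e = M + 3..K + 2. T e)"
      using split[of 3 "M + 2" "K + 2"] \<open>M \<le> K\<close> by (simp add: numeral_eq_Suc del: sum.cl_ivl_Suc)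
    ultimately show ?thesis
      using shift[of 0 M] shift[of M K]
      unfolding QM(1) unfolding QM(2)
      by (simp add: minus True Int_ind_def ac_simps del: sum.cl_ivl_Suc)
  next
    case False
    have "(2 / of_nat q :: rat) \<notin> \<int>"
    proof
      assume "(2 / of_nat q :: rat) \<in> \<int>"
      then obtain i where "2 / of_nat q = (of_int i :: rat)"
        by (elim Ints_cases)
      moreover have "2 / of_nat q > (0 :: rat)" "2 / of_nat q < (1 :: rat)"
        using q2 False by (auto simp: field_simps)
      ultimately have "0 < i" "i < 1"
        by auto
      then show False
        by simp
    qed
    then have Int0: "Int_ind (2 / of_nat q) = (0 :: 'a poly fract)"
      by (simp add: Int_ind_def)
    \<comment> \<open>The progression lemma applies with m = M + K, to (l, u, v) = (M, K, 2) and (0,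
      M, 1).\<close>
    have bounds: "2 * Q - R + 2 = (q - 1) * (M + K) + 3" "Q + 1 = (q - 1) * K + 2"
      "Q - R + 2 = (q - 1) * M + 2" "Q - R + 1 = (q - 1) * M + 1"
      using RQ unfolding distrib_left M K by simp_all
    have c: "q - 1 \<ge> 2"
      using q2 False by simp
    show ?thesis
      using sum_arithmetic_progression_filter[OF c, of K "M + K" 2 T M]
        sum_arithmetic_progression_filter[OF c, of M "M + K" 1 T 0]
      unfolding bounds Int0 by (simp del: sum.cl_ivl_Suc One_nat_def add_2_eq_Suc' add_Suc_right Suc_eq_plus1)
  qed
  also have "T 2 = power_sum2 d 2 (2 * int q ^ n - int q ^ s)"
    using RQ by (simp add: T_def of_nat_diff) (simp add: Q_def R_def)
  also have "(\<Sum>j = 1..M. T (3 + (j - 1) * (q - 1))) =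
      (\<Sum>j = 1..M. power_sum2 d (3 + (int j - 1) * (int q - 1))
        (2 * int q ^ n - int q ^ s - 1 - (int j - 1) * (int q - 1)))"
    using \<open>M \<le> K\<close> by (intro sum.cong refl T) auto
  also have "(\<Sum>j = M + 1..K. T (3 + (j - 1) * (q - 1))) =
      (\<Sum>j = M + 1..K. power_sum2 d (3 + (int j - 1) * (int q - 1))
        (2 * int q ^ n - int q ^ s - 1 - (int j - 1) * (int q - 1)))"
    by (intro sum.cong refl T) auto
  finally show ?thesis
    unfolding M_def K_def Q_def R_def .
qed

end
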